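(* Let $n,r\in\mathbb N$. Then $\widetilde{\mathcal Q}_n^{(r)}$ is a closed subset of the space $\mathcal S^n$ of real symmetric $n\times n$ matrices.
   Context: $\mathbb N=\{0,1,2,\dots\}$. For $\beta\in\mathbb N^n$ put $|\beta|=\sum_i\beta_i$ and $x^\beta=x_1^{\beta_1}\cdots x_n^{\beta_n}$. For $n,r\in\mathbb N$: $\mathcal N_{n,r}$ is the set of homogeneous polynomials of degree $r$ in $x_1,\dots,x_n$ with nonnegative coefficients (including $0$); $\mathcal H_{n,r}$ is the cone of homogeneous polynomials of degree $r+2$ (including $0$) of the form $\sum_{\beta\in\mathbb N^n,\ |\beta|\in\{r,r+2\}}x^\beta\sigma_\beta$, where each $\sigma_\beta$ is a sum of squares of real polynomials of degree at most $r+2-|\beta|$. $\|p\|_1$ is the sum of the absolute values of the coefficients of $p$. Define $$\widetilde{\mathcal Q}_n^{(r)}=\{M\in\mathcal S^n:\ p\cdot x^TMx\in\mathcal H_{n,r}\text{ for some }p\in\mathcal N_{n,r}\text{ with }\|p\|_1=1\}.$$ *)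

theory Defs
  imports "HOL-Analysis.Analysis" "HOL-Library.Poly_Mapping"
begin

text \<open>
  Exponents are finitely supported functions on \<^typ>\<open>nat\<close>. The variables \<open>x\<^sub>1, \<dots>, x\<^sub>n\<close> are numbered
  \<open>0, \<dots>, n - 1\<close>, and \<open>\<nat>\<^sup>n\<close> is the set of exponents supported on \<open>{..<n}\<close>. The product of
  polynomials is the convolution product of \<^theory>\<open>HOL-Library.Poly_Mapping\<close>.
\<close>

type_synonym expo = "nat \<Rightarrow>\<^sub>0 nat"
type_synonym rpoly = "expo \<Rightarrow>\<^sub>0 real"

definition expos :: "nat \<Rightarrow> expo set" where
  "expos n = {\<beta>. Poly_Mapping.keys \<beta> \<subseteq> {..<n}}"

definition edeg :: "expo \<Rightarrow> nat" where
  "edeg \<beta> = (\<Sum>i\<in>Poly_Mapping.keys \<beta>. Poly_Mapping.lookup \<beta> i)"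

definition polys_le :: "nat \<Rightarrow> nat \<Rightarrow> rpoly set" where
  "polys_le n d = {p. \<forall>\<beta>\<in>Poly_Mapping.keys p. \<beta> \<in> expos n \<and> edeg \<beta> \<le> d}"

definition forms :: "nat \<Rightarrow> nat \<Rightarrow> rpoly set" where
  "forms n d = {p. \<forall>\<beta>\<in>Poly_Mapping.keys p. \<beta> \<in> expos n \<and> edeg \<beta> = d}"

definition nonneg_forms :: "nat \<Rightarrow> nat \<Rightarrow> rpoly set" where
  "nonneg_forms n r = {p \<in> forms n r. \<forall>\<beta>. 0 \<le> Poly_Mapping.lookup p \<beta>}"

definition l1norm :: "rpoly \<Rightarrow> real" where
  "l1norm p = (\<Sum>\<beta>\<in>Poly_Mapping.keys p. \<bar>Poly_Mapping.lookup p \<beta>\<bar>)"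

definition sos :: "nat \<Rightarrow> nat \<Rightarrow> rpoly set" where
  "sos n d = {\<Sum>q\<leftarrow>qs. q\<^sup>2 | qs. set qs \<subseteq> polys_le n d}"

text \<open>
  In \<open>sos n d\<close> the degree bound \<open>d\<close> is on the polynomials being squared. In \<open>cone_H\<close> below this gives
  the same set as bounding the degree of \<open>\<sigma> \<beta>\<close> itself by \<open>r + 2 - edeg \<beta>\<close>. Only \<open>edeg \<beta> = r\<close> matters:
  as the total is a form of degree \<open>r + 2\<close>, its part of degree \<open>r + 4\<close>, which is the sum of
  \<open>x\<^sup>\<beta>\<close> times squares of the quadratic parts, vanishes; every summand is nonnegative on the
  positive orthant, so all these quadratic parts are zero.
\<close>

definition cone_H :: "nat \<Rightarrow> nat \<Rightarrow> rpoly set" where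
  "cone_H n r = {f \<in> forms n (r + 2). \<exists>\<sigma>.
     (\<forall>\<beta>\<in>{\<beta> \<in> expos n. edeg \<beta> \<in> {r, r + 2}}. \<sigma> \<beta> \<in> sos n (r + 2 - edeg \<beta>)) \<and>
     f = (\<Sum>\<beta>\<in>{\<beta> \<in> expos n. edeg \<beta> \<in> {r, r + 2}}. Poly_Mapping.single \<beta> 1 * \<sigma> \<beta>)}"

text \<open>The index set of the sum in \<open>cone_H\<close> is finite, so the sum is not the default value.\<close>

lemma finite_expos_edeg_le: "finite {\<beta> \<in> expos n. edeg \<beta> \<le> d}"
proof -
  let ?A = "{\<beta> \<in> expos n. edeg \<beta> \<le> d}"
  have "Poly_Mapping.lookup ` ?A \<subseteq> {f. \<forall>i. (i \<in> {..<n} \<longrightarrow> f i \<in> {..d}) \<and> (i \<notin> {..<n} \<longrightarrow> f i = 0)}"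
  proof (rule image_subsetI, rule CollectI, rule allI)
    fix \<beta> i assume "\<beta> \<in> ?A"
    then have \<beta>: "\<beta> \<in> expos n" and d: "edeg \<beta> \<le> d"
      by simp_all
    have "Poly_Mapping.lookup \<beta> i \<le> edeg \<beta>"
    proof (cases "i \<in> Poly_Mapping.keys \<beta>")
      case True
      then show ?thesis
        unfolding edeg_def by (intro member_le_sum) simp_all
    next
      case False
      then show ?thesis
        by (simp add: in_keys_iff)
    qed
    moreover have "Poly_Mapping.lookup \<beta> i = 0" if "i \<notin> {..<n}"
      using \<beta> that by (auto simp: expos_def in_keys_iff)
    ultimately show "(i \<in> {..<n} \<longrightarrow> Poly_Mapping.lookup \<beta> i \<in> {..d}) \<and>
        (i \<notin> {..<n} \<longrightarrow> Poly_Mapping.lookup \<beta> i = 0)"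
      using d by auto
  qed
  moreover have "finite {f. \<forall>i. (i \<in> {..<n} \<longrightarrow> f i \<in> {..d}) \<and> (i \<notin> {..<n} \<longrightarrow> f i = (0::nat))}"
    by (rule finite_set_of_finite_funs) auto
  ultimately have "finite (Poly_Mapping.lookup ` ?A)"
    by (rule finite_subset)
  then show ?thesis
  proof (rule finite_imageD)
    show "inj_on Poly_Mapping.lookup ?A"
      by (rule inj_onI) (simp add: lookup_inject)
  qed
qed

lemma finite_expos_cone_H: "finite {\<beta> \<in> expos n. edeg \<beta> \<in> {r, r + 2}}"
  by (rule finite_subset[OF _ finite_expos_edeg_le[of n "r + 2"]]) auto

text \<open>
  Matrices are functions with entries \<open>M i j\<close> for \<open>i, j < n\<close>, extended by zero, so that \<open>n = 0\<close> is
  included. The topology on \<^typ>\<open>nat \<Rightarrow> nat \<Rightarrow> real\<close> is the product topology; on \<open>sym_mats n\<close> it is that of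
  convergence of the \<open>n\<^sup>2\<close> entries, i.e. the usual topology of the finite-dimensional space.
\<close>

definition sym_mats :: "nat \<Rightarrow> (nat \<Rightarrow> nat \<Rightarrow> real) set" where
  "sym_mats n = {M. (\<forall>i j. M i j = M j i) \<and> (\<forall>i j. \<not> (i < n \<and> j < n) \<longrightarrow> M i j = 0)}"

definition quad_form :: "nat \<Rightarrow> (nat \<Rightarrow> nat \<Rightarrow> real) \<Rightarrow> rpoly" where
  "quad_form n M = (\<Sum>i<n. \<Sum>j<n.
     Poly_Mapping.single (Poly_Mapping.single i 1 + Poly_Mapping.single j 1) (M i j))"

definition Q_tilde :: "nat \<Rightarrow> nat \<Rightarrow> (nat \<Rightarrow> nat \<Rightarrow> real) set" where
  "Q_tilde n r = {M \<in> sym_mats n. \<exists>p \<in> nonneg_forms n r. l1norm p = 1 \<and> p * quad_form n M \<in> cone_H n r}"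

end

theory Submission imports Defs begin

text \<open>
  Let \<open>M\<^sub>k \<rightarrow> N\<close> with multipliers \<open>p\<^sub>k\<close>. The admissible multipliers form a compact set (a simplex of
  coefficient vectors), so along a subsequence \<open>p\<^sub>k \<rightarrow> p\<close> with \<open>p\<close> admissible
  (\<open>multipliers_compact\<close>), and \<open>p\<^sub>k \<cdot> x\<^sup>T M\<^sub>k x\<close> tends to \<open>p \<cdot> x\<^sup>T N x\<close> coefficientwise. It remains to see
  that the cone \<open>cone_H n r\<close> is closed (\<open>cone_H_closed\<close>).

  For this, the number of squares must be bounded: rotating pairs of squares eliminates one monomial
  at a time, so a sum of squares of polynomials supported on a finite set \<open>A\<close> of monomials is a sum of
  \<open>card A\<close> such squares (\<open>sum_of_squares_card_support\<close>). Every element of the cone thus is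
  \<open>\<Sum>i\<in>I. x\<^bsup>\<beta> i\<^esup> q\<^sub>i\<^sup>2\<close> over one fixed finite index set \<open>I\<close>, with the supports of the \<open>q\<^sub>i\<close> in fixed finite sets.

  Given a convergent sequence of such sums, scale all \<open>q\<^sub>i\<close> by a common factor \<open>t \<le> 1\<close> so that their
  coefficients stay bounded, and pass to limits \<open>h\<^sub>i\<close> of the scaled polynomials and \<open>\<tau>\<close> of the
  factors; then \<open>\<Sum>i\<in>I. x\<^bsup>\<beta> i\<^esup> h\<^sub>i\<^sup>2 = \<tau>\<^sup>2 f\<close>. If \<open>\<tau> > 0\<close>, dividing by it represents \<open>f\<close>. The case \<open>\<tau> = 0\<close> cannot
  occur: leading terms of the summands \<open>x\<^sup>\<beta> h\<^sup>2\<close> have positive coefficients and cannot cancel, so all \<open>h\<^sub>i\<close>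
  would vanish (\<open>weighted_squares_eq_0_imp\<close>), while the scaling keeps their total size near 1.
\<close>

section \<open>Leading coefficients of weighted squares\<close>

lemma lookup_mult_finite:
  fixes p q :: "'a::monoid_add \<Rightarrow>\<^sub>0 'b::semiring_0"
  assumes "finite A" "finite B" "Poly_Mapping.keys p \<subseteq> A" "Poly_Mapping.keys q \<subseteq> B"
  shows "Poly_Mapping.lookup (p * q) c =
    (\<Sum>(a, b)\<in>A \<times> B. if c = a + b then Poly_Mapping.lookup p a * Poly_Mapping.lookup q b else 0)"
proof -
  have "Poly_Mapping.lookup (p * q) c =
      (\<Sum>(a, b). Poly_Mapping.lookup p a * Poly_Mapping.lookup q b when c = a + b)"
    by (transfer fixing: c) (rule prod_fun_unfold_prod)
  also have "\<dots> = (\<Sum>(a, b)\<in>A \<times> B.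
      Poly_Mapping.lookup p a * Poly_Mapping.lookup q b when c = a + b)"
  proof (rule Sum_any.expand_superset)
    show "finite (A \<times> B)"
      using assms by simp
    show "{x. (case x of (a, b) \<Rightarrow>
        Poly_Mapping.lookup p a * Poly_Mapping.lookup q b when c = a + b) \<noteq> 0} \<subseteq> A \<times> B"
      using assms(3,4) mult_not_zero[of "Poly_Mapping.lookup p _"]
      unfolding subset_iff in_keys_iff when_def by (clarsimp split: if_splits)
  qed
  finally show ?thesis
    by (simp add: when_def)
qed

lemma lookup_const_mult:
  fixes p :: "'a::monoid_add \<Rightarrow>\<^sub>0 'b::semiring_0"
  shows "Poly_Mapping.lookup (Poly_Mapping.single 0 c * p) \<gamma> = c * Poly_Mapping.lookup p \<gamma>"
proof -
  have "Poly_Mapping.lookup (Poly_Mapping.single 0 c * p) \<gamma> =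
      (\<Sum>(a, b)\<in>{0} \<times> insert \<gamma> (Poly_Mapping.keys p). if \<gamma> = a + b
        then Poly_Mapping.lookup (Poly_Mapping.single 0 c) a * Poly_Mapping.lookup p b else 0)"
    by (rule lookup_mult_finite) auto
  also have "\<dots> = (\<Sum>b\<in>insert \<gamma> (Poly_Mapping.keys p).
      if \<gamma> = b then c * Poly_Mapping.lookup p b else 0)"
    by (subst sum.cartesian_product[symmetric]) simp
  also have "\<dots> = c * Poly_Mapping.lookup p \<gamma>"
    by (subst sum.delta') auto
  finally show ?thesis .
qed

lemma keys_const_mult_subset:
  fixes p :: "'a::monoid_add \<Rightarrow>\<^sub>0 'b::semiring_0"
  shows "Poly_Mapping.keys (Poly_Mapping.single 0 c * p) \<subseteq> Poly_Mapping.keys p"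
  by (auto simp: in_keys_iff lookup_const_mult)

text \<open>
  Multiplicativity of leading coefficients. Allowing upper bounds \<open>a\<close>, \<open>b\<close> of the supports instead of
  their maxima covers zero polynomials as well.
\<close>

lemma lookup_mult_upper_bounds:
  fixes p q :: "'a::{linorder, ordered_cancel_comm_monoid_add} \<Rightarrow>\<^sub>0 'b::semiring_0"
  assumes "\<And>x. x \<in> Poly_Mapping.keys p \<Longrightarrow> x \<le> a" "\<And>y. y \<in> Poly_Mapping.keys q \<Longrightarrow> y \<le> b"
  shows "Poly_Mapping.lookup (p * q) (a + b) = Poly_Mapping.lookup p a * Poly_Mapping.lookup q b"
proof -
  let ?A = "insert a (Poly_Mapping.keys p)" and ?B = "insert b (Poly_Mapping.keys q)"
  have eq: "a + b = x + y \<longleftrightarrow> (x, y) = (a, b)" if "x \<in> ?A" "y \<in> ?B" for x y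
  proof -
    have "x \<le> a" "y \<le> b"
      using that assms by auto
    then show ?thesis
      using add_less_le_mono[of x a y b] add_le_less_mono[of x a y b] by force
  qed
  have "Poly_Mapping.lookup (p * q) (a + b) = (\<Sum>(x, y)\<in>?A \<times> ?B. if a + b = x + y
      then Poly_Mapping.lookup p x * Poly_Mapping.lookup q y else 0)"
    by (rule lookup_mult_finite) auto
  also have "\<dots> = (\<Sum>z\<in>?A \<times> ?B. if z = (a, b)
      then Poly_Mapping.lookup p (fst z) * Poly_Mapping.lookup q (snd z) else 0)"
  proof (rule sum.cong[OF refl])
    fix z assume "z \<in> ?A \<times> ?B"
    then show "(case z of (x, y) \<Rightarrow> if a + b = x + y
        then Poly_Mapping.lookup p x * Poly_Mapping.lookup q y else 0) =
      (if z = (a, b) then Poly_Mapping.lookup p (fst z) * Poly_Mapping.lookup q (snd z) else 0)"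
      using eq[of "fst z" "snd z"] by (cases z) auto
  qed
  also have "\<dots> = Poly_Mapping.lookup p a * Poly_Mapping.lookup q b"
    by (subst sum.delta) simp_all
  finally show ?thesis .
qed

lemma keys_mult_upper_bounds:
  fixes p q :: "'a::{linorder, ordered_cancel_comm_monoid_add} \<Rightarrow>\<^sub>0 'b::semiring_0"
  assumes "\<And>x. x \<in> Poly_Mapping.keys p \<Longrightarrow> x \<le> a" "\<And>y. y \<in> Poly_Mapping.keys q \<Longrightarrow> y \<le> b"
    and "z \<in> Poly_Mapping.keys (p * q)"
  shows "z \<le> a + b"
  using keys_mult[of p q] assms by (auto intro!: add_mono)

text \<open>
  No cancellation: with respect to a monomial order, the leading coefficient of \<open>x\<^sup>\<beta> q\<^sup>2\<close> is the square of
  that of \<open>q\<close>. At the largest of all leading monomials every summand has a nonnegative coefficient and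
  at least one has a positive coefficient.
\<close>

lemma weighted_squares_eq_0_imp:
  fixes \<beta> :: "'i \<Rightarrow> expo" and q :: "'i \<Rightarrow> rpoly"
  assumes "finite I" and zero: "(\<Sum>i\<in>I. Poly_Mapping.single (\<beta> i) 1 * (q i)\<^sup>2) = 0" and "i \<in> I"
  shows "q i = 0"
proof (rule ccontr)
  assume "q i \<noteq> 0"
  define J where "J = {i \<in> I. q i \<noteq> 0}"
  define m where "m i = Max (Poly_Mapping.keys (q i))" for i
  define \<mu> where "\<mu> = Max ((\<lambda>i. \<beta> i + (m i + m i)) ` J)"
  have J: "finite J" "J \<noteq> {}"
    using \<open>finite I\<close> \<open>i \<in> I\<close> \<open>q i \<noteq> 0\<close> by (auto simp: J_def)
  have le: "\<beta> j + (m j + m j) \<le> \<mu>" if "j \<in> J" for j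
    using J that by (auto simp: \<mu>_def)
  obtain t where t: "t \<in> J" "\<mu> = \<beta> t + (m t + m t)"
    using Max_in[of "(\<lambda>i. \<beta> i + (m i + m i)) ` J"] J unfolding \<mu>_def by blast
  have top: "Poly_Mapping.lookup (Poly_Mapping.single (\<beta> j) 1 * (q j)\<^sup>2) (\<beta> j + (m j + m j)) =
      (Poly_Mapping.lookup (q j) (m j))\<^sup>2"
    and bound: "x \<in> Poly_Mapping.keys (Poly_Mapping.single (\<beta> j) 1 * (q j)\<^sup>2)
      \<Longrightarrow> x \<le> \<beta> j + (m j + m j)" for j x
  proof -
    have q: "x \<le> m j" if "x \<in> Poly_Mapping.keys (q j)" for x
      using that by (auto simp: m_def)
    have q2: "x \<le> m j + m j" if "x \<in> Poly_Mapping.keys ((q j)\<^sup>2)" for x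
      using that keys_mult_upper_bounds[of "q j" "m j" "q j" "m j"] q
      by (auto simp: power2_eq_square)
    have b: "x \<le> \<beta> j" if "x \<in> Poly_Mapping.keys (Poly_Mapping.single (\<beta> j) (1::real))" for x
      using that by simp
    show "Poly_Mapping.lookup (Poly_Mapping.single (\<beta> j) 1 * (q j)\<^sup>2) (\<beta> j + (m j + m j)) =
      (Poly_Mapping.lookup (q j) (m j))\<^sup>2"
      using lookup_mult_upper_bounds[of "Poly_Mapping.single (\<beta> j) (1::real)" "\<beta> j" "(q j)\<^sup>2"
          "m j + m j", OF b q2]
        lookup_mult_upper_bounds[of "q j" "m j" "q j" "m j", OF q q]
      by (simp add: power2_eq_square)
    show "x \<le> \<beta> j + (m j + m j)"
      if "x \<in> Poly_Mapping.keys (Poly_Mapping.single (\<beta> j) 1 * (q j)\<^sup>2)"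
      using keys_mult_upper_bounds[OF b q2 that] .
  qed
  have nonneg: "0 \<le> Poly_Mapping.lookup (Poly_Mapping.single (\<beta> j) 1 * (q j)\<^sup>2) \<mu>"
    if "j \<in> I" for j
  proof (cases "j \<in> J \<and> \<mu> = \<beta> j + (m j + m j)")
    case True
    then show ?thesis
      using top[of j] by simp
  next
    case False
    then have "j \<notin> J \<or> \<beta> j + (m j + m j) < \<mu>"
      using le[of j] by auto
    then have "\<mu> \<notin> Poly_Mapping.keys (Poly_Mapping.single (\<beta> j) 1 * (q j)\<^sup>2)"
      using bound[of \<mu> j] that by (auto simp: J_def)
    then show ?thesis
      by (simp add: in_keys_iff)
  qed
  have "m t \<in> Poly_Mapping.keys (q t)"
    using t unfolding m_def by (intro Max_in) (auto simp: J_def)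
  then have "0 < Poly_Mapping.lookup (Poly_Mapping.single (\<beta> t) 1 * (q t)\<^sup>2) \<mu>"
    using top[of t] t(2) by (simp add: in_keys_iff)
  then have "0 < (\<Sum>i\<in>I. Poly_Mapping.lookup (Poly_Mapping.single (\<beta> i) 1 * (q i)\<^sup>2) \<mu>)"
    using t(1) \<open>finite I\<close> nonneg by (intro sum_pos2[where i = t]) (auto simp: J_def)
  also have "\<dots> = 0"
    unfolding lookup_sum[symmetric] zero by simp
  finally show False
    by simp
qed

section \<open>Sums of boundedly many squares\<close>

lemma rotate_squares:
  fixes c s x y :: "'a::comm_ring_1"
  assumes "c\<^sup>2 + s\<^sup>2 = 1"
  shows "(c * x + s * y)\<^sup>2 + (c * y - s * x)\<^sup>2 = x\<^sup>2 + y\<^sup>2"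
proof -
  have "(c * x + s * y)\<^sup>2 + (c * y - s * x)\<^sup>2 = (c\<^sup>2 + s\<^sup>2) * (x\<^sup>2 + y\<^sup>2)"
    by (simp add: power2_eq_square algebra_simps)
  then show ?thesis
    using assms by simp
qed

text \<open>
  The pair \<open>(p, q)\<close> is rotated by the angle that turns the pair of coefficients at \<open>a\<close> into one whose second
  entry is zero.
\<close>

lemma two_squares_eliminate:
  fixes p q :: rpoly
  shows "\<exists>p' q'. p'\<^sup>2 + q'\<^sup>2 = p\<^sup>2 + q\<^sup>2 \<and> Poly_Mapping.lookup q' a = 0 \<and>
    Poly_Mapping.keys p' \<union> Poly_Mapping.keys q' \<subseteq> Poly_Mapping.keys p \<union> Poly_Mapping.keys q"
proof (cases "Poly_Mapping.lookup q a = 0")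
  case True
  then show ?thesis
    by blast
next
  case False
  define u v h where "u = Poly_Mapping.lookup p a" and "v = Poly_Mapping.lookup q a"
    and "h = sqrt (u\<^sup>2 + v\<^sup>2)"
  have h: "h\<^sup>2 = u\<^sup>2 + v\<^sup>2" "h \<noteq> 0"
    using False by (auto simp: h_def v_def add_nonneg_eq_0_iff)
  define c s :: rpoly where "c = Poly_Mapping.single 0 (u / h)" and "s = Poly_Mapping.single 0 (v / h)"
  have "(u / h)\<^sup>2 + (v / h)\<^sup>2 = 1"
    unfolding power_divide add_divide_distrib[symmetric] h(1)[symmetric] using h(2) by simp
  then have "c\<^sup>2 + s\<^sup>2 = 1"
    by (simp add: c_def s_def power2_eq_square mult_single single_add[symmetric])
  note sq = rotate_squares[OF this, of p q]
  have "Poly_Mapping.lookup (c * q - s * p) a = 0"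
    by (simp add: lookup_minus c_def s_def lookup_const_mult u_def v_def)
  moreover have "Poly_Mapping.keys (c * p + s * q) \<union> Poly_Mapping.keys (c * q - s * p) \<subseteq>
      Poly_Mapping.keys p \<union> Poly_Mapping.keys q"
    by (auto simp: in_keys_iff lookup_add lookup_minus c_def s_def lookup_const_mult)
  ultimately show ?thesis
    using sq by blast
qed

text \<open>
  Rotating each member of the list in turn against an accumulator \<open>p\<close> moves all occurrences of the
  monomial \<open>a\<close> into \<open>p\<close>.
\<close>

lemma sum_of_squares_eliminate:
  fixes qs :: "rpoly list"
  assumes "\<And>q. q \<in> set qs \<Longrightarrow> Poly_Mapping.keys q \<subseteq> insert a A"
  shows "\<exists>p qs'. (\<Sum>q\<leftarrow>qs. q\<^sup>2) = p\<^sup>2 + (\<Sum>q\<leftarrow>qs'. q\<^sup>2) \<and> Poly_Mapping.keys p \<subseteq> insert a A \<and>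
    (\<forall>q\<in>set qs'. Poly_Mapping.keys q \<subseteq> A)"
  using assms
proof (induction qs)
  case Nil
  show ?case
    by (rule exI[of _ 0], rule exI[of _ "[]"]) simp
next
  case (Cons q qs)
  then obtain p qs' where IH: "(\<Sum>q\<leftarrow>qs. q\<^sup>2) = p\<^sup>2 + (\<Sum>q\<leftarrow>qs'. q\<^sup>2)"
      "Poly_Mapping.keys p \<subseteq> insert a A" "\<forall>q\<in>set qs'. Poly_Mapping.keys q \<subseteq> A"
    by force
  obtain p' q' where r: "p'\<^sup>2 + q'\<^sup>2 = p\<^sup>2 + q\<^sup>2" "Poly_Mapping.lookup q' a = 0"
      "Poly_Mapping.keys p' \<union> Poly_Mapping.keys q' \<subseteq> Poly_Mapping.keys p \<union> Poly_Mapping.keys q"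
    using two_squares_eliminate by blast
  have "Poly_Mapping.keys q \<subseteq> insert a A"
    using Cons.prems by simp
  with IH(2) r(3) have keys: "Poly_Mapping.keys p' \<subseteq> insert a A" "Poly_Mapping.keys q' \<subseteq> insert a A"
    by blast+
  have "a \<notin> Poly_Mapping.keys q'"
    using r(2) by (simp add: in_keys_iff)
  with keys(2) have "Poly_Mapping.keys q' \<subseteq> A"
    by blast
  moreover have "(\<Sum>q\<leftarrow>q # qs. q\<^sup>2) = p'\<^sup>2 + (\<Sum>q\<leftarrow>q' # qs'. q\<^sup>2)"
    using IH(1) r(1) by (simp add: algebra_simps)
  ultimately show ?case
    using IH(3) keys(1) by (intro exI[of _ p'] exI[of _ "q' # qs'"]) auto
qed

text \<open>
  Each elimination step costs one square and removes one monomial, as in bringing a Gram matrix to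
  triangular form.
\<close>

lemma sum_of_squares_card_support:
  fixes qs :: "rpoly list"
  assumes "finite A" "\<And>q. q \<in> set qs \<Longrightarrow> Poly_Mapping.keys q \<subseteq> A"
  shows "\<exists>h. (\<forall>a\<in>A. Poly_Mapping.keys (h a) \<subseteq> A) \<and> (\<Sum>q\<leftarrow>qs. q\<^sup>2) = (\<Sum>a\<in>A. (h a)\<^sup>2)"
  using assms
proof (induction A arbitrary: qs rule: finite_induct)
  case empty
  then have "\<forall>q\<in>set qs. q = 0"
    by auto
  then have "(\<Sum>q\<leftarrow>qs. q\<^sup>2) = 0"
    by (induction qs) auto
  then show ?case
    by simp
next
  case (insert a A)
  obtain p qs' where p: "(\<Sum>q\<leftarrow>qs. q\<^sup>2) = p\<^sup>2 + (\<Sum>q\<leftarrow>qs'. q\<^sup>2)"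
      "Poly_Mapping.keys p \<subseteq> insert a A" "\<forall>q\<in>set qs'. Poly_Mapping.keys q \<subseteq> A"
    using sum_of_squares_eliminate[of qs a A] insert.prems(1) by blast
  obtain h where h: "\<forall>a\<in>A. Poly_Mapping.keys (h a) \<subseteq> A" "(\<Sum>q\<leftarrow>qs'. q\<^sup>2) = (\<Sum>a\<in>A. (h a)\<^sup>2)"
    using insert.IH[of qs'] p(3) by blast
  have "(\<Sum>b\<in>insert a A. ((h(a := p)) b)\<^sup>2) = p\<^sup>2 + (\<Sum>b\<in>A. (h b)\<^sup>2)"
  proof -
    have "(\<Sum>b\<in>A. ((h(a := p)) b)\<^sup>2) = (\<Sum>b\<in>A. (h b)\<^sup>2)"
      using insert.hyps by (intro sum.cong) auto
    then show ?thesis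
      using insert.hyps by simp
  qed
  then show ?case
    using p(1,2) h by (intro exI[of _ "h(a := p)"]) auto
qed

definition monos_le :: "nat \<Rightarrow> nat \<Rightarrow> expo set" where
  "monos_le n d = {\<gamma> \<in> expos n. edeg \<gamma> \<le> d}"

lemma finite_monos_le: "finite (monos_le n d)"
  unfolding monos_le_def by (rule finite_expos_edeg_le)

text \<open>
  The squares occurring in an element of the cone are indexed by the weight \<open>\<beta>\<close> together with one of the
  monomials that may occur in the polynomials squared under that weight.
\<close>

definition square_index :: "nat \<Rightarrow> nat \<Rightarrow> (expo \<times> expo) set" where
  "square_index n r =
    (SIGMA \<beta>:{\<beta> \<in> expos n. edeg \<beta> \<in> {r, r + 2}}. monos_le n (r + 2 - edeg \<beta>))"

lemma finite_square_index: "finite (square_index n r)"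
  unfolding square_index_def by (intro finite_SigmaI finite_expos_cone_H finite_monos_le)

lemma sos_iff_card_squares:
  shows "\<sigma> \<in> sos n d \<longleftrightarrow>
    (\<exists>h. (\<forall>a\<in>monos_le n d. Poly_Mapping.keys (h a) \<subseteq> monos_le n d) \<and> \<sigma> = (\<Sum>a\<in>monos_le n d. (h a)\<^sup>2))"
proof
  have fin: "finite (monos_le n d)"
    by (rule finite_monos_le)
  have polys: "p \<in> polys_le n d \<longleftrightarrow> Poly_Mapping.keys p \<subseteq> monos_le n d" for p
    by (auto simp: polys_le_def monos_le_def)
  {
    assume "\<sigma> \<in> sos n d"
    then obtain qs where "set qs \<subseteq> polys_le n d" "\<sigma> = (\<Sum>q\<leftarrow>qs. q\<^sup>2)"
      by (auto simp: sos_def)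
    then show "\<exists>h. (\<forall>a\<in>monos_le n d. Poly_Mapping.keys (h a) \<subseteq> monos_le n d) \<and> \<sigma> = (\<Sum>a\<in>monos_le n d. (h a)\<^sup>2)"
      using sum_of_squares_card_support[OF fin, of qs] polys by blast
  next
    assume "\<exists>h. (\<forall>a\<in>monos_le n d. Poly_Mapping.keys (h a) \<subseteq> monos_le n d) \<and> \<sigma> = (\<Sum>a\<in>monos_le n d. (h a)\<^sup>2)"
    then obtain h where h: "\<forall>a\<in>monos_le n d. Poly_Mapping.keys (h a) \<subseteq> monos_le n d" "\<sigma> = (\<Sum>a\<in>monos_le n d. (h a)\<^sup>2)"
      by blast
    obtain as where as: "set as = monos_le n d" "distinct as"
      using finite_distinct_list[OF fin] by blast
    have "\<sigma> = (\<Sum>q\<leftarrow>map h as. q\<^sup>2)"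
      using h(2) as by (simp add: sum.distinct_set_conv_list[symmetric] comp_def)
    moreover have "set (map h as) \<subseteq> polys_le n d"
      using h(1) as polys by auto
    ultimately show "\<sigma> \<in> sos n d"
      unfolding sos_def by blast
  }
qed

lemma cone_H_iff_squares:
  shows "f \<in> cone_H n r \<longleftrightarrow> f \<in> forms n (r + 2) \<and>
    (\<exists>q. (\<forall>i\<in>square_index n r.
           Poly_Mapping.keys (q i) \<subseteq> monos_le n (r + 2 - edeg (fst i))) \<and>
      f = (\<Sum>i\<in>square_index n r.
             Poly_Mapping.single (fst i) 1 * (q i)\<^sup>2))"
proof -
  let ?B = "{\<beta> \<in> expos n. edeg \<beta> \<in> {r, r + 2}}"
  have fin: "finite ?B" "finite (monos_le n d)" for d
    by (rule finite_expos_cone_H finite_monos_le)+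
  have split: "(\<Sum>i\<in>square_index n r. Poly_Mapping.single (fst i) 1 * (q i)\<^sup>2) =
      (\<Sum>\<beta>\<in>?B. Poly_Mapping.single \<beta> 1 * (\<Sum>a\<in>monos_le n (r + 2 - edeg \<beta>). (q (\<beta>, a))\<^sup>2))"
    for q :: "expo \<times> expo \<Rightarrow> rpoly"
    using sum.Sigma[OF fin(1), of "\<lambda>\<beta>. monos_le n (r + 2 - edeg \<beta>)"
        "\<lambda>\<beta> a. Poly_Mapping.single \<beta> 1 * (q (\<beta>, a))\<^sup>2"] fin(2)
    by (simp add: square_index_def sum_distrib_left split_beta)
  have "(\<exists>\<sigma>. (\<forall>\<beta>\<in>?B. \<sigma> \<beta> \<in> sos n (r + 2 - edeg \<beta>)) \<and>
        f = (\<Sum>\<beta>\<in>?B. Poly_Mapping.single \<beta> 1 * \<sigma> \<beta>)) \<longleftrightarrow>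
      (\<exists>q. (\<forall>i\<in>square_index n r. Poly_Mapping.keys (q i) \<subseteq> monos_le n (r + 2 - edeg (fst i))) \<and>
        f = (\<Sum>i\<in>square_index n r. Poly_Mapping.single (fst i) 1 * (q i)\<^sup>2))" (is "?L \<longleftrightarrow> ?R")
  proof
    assume ?L
    then obtain \<sigma> where \<sigma>: "\<And>\<beta>. \<beta> \<in> ?B \<Longrightarrow> \<sigma> \<beta> \<in> sos n (r + 2 - edeg \<beta>)"
        "f = (\<Sum>\<beta>\<in>?B. Poly_Mapping.single \<beta> 1 * \<sigma> \<beta>)"
      by blast
    have "\<forall>\<beta>\<in>?B. \<exists>h. (\<forall>a\<in>monos_le n (r + 2 - edeg \<beta>). Poly_Mapping.keys (h a) \<subseteq> monos_le n (r + 2 - edeg \<beta>)) \<and>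
        \<sigma> \<beta> = (\<Sum>a\<in>monos_le n (r + 2 - edeg \<beta>). (h a)\<^sup>2)"
      using \<sigma>(1) unfolding sos_iff_card_squares by blast
    then obtain h where h: "\<forall>\<beta>\<in>?B. (\<forall>a\<in>monos_le n (r + 2 - edeg \<beta>).
          Poly_Mapping.keys (h \<beta> a) \<subseteq> monos_le n (r + 2 - edeg \<beta>)) \<and>
        \<sigma> \<beta> = (\<Sum>a\<in>monos_le n (r + 2 - edeg \<beta>). (h \<beta> a)\<^sup>2)"
      by (rule bchoice[THEN exE])
    have "f = (\<Sum>i\<in>square_index n r. Poly_Mapping.single (fst i) 1 * ((\<lambda>(\<beta>, a). h \<beta> a) i)\<^sup>2)"
      unfolding split \<sigma>(2) using h by (intro sum.cong) auto
    moreover have "\<forall>i\<in>square_index n r. Poly_Mapping.keys ((\<lambda>(\<beta>, a). h \<beta> a) i) \<subseteq> monos_le n (r + 2 - edeg (fst i))"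
      using h by (fastforce simp: square_index_def)
    ultimately show ?R
      by blast
  next
    assume ?R
    then obtain q where q: "\<forall>i\<in>square_index n r. Poly_Mapping.keys (q i) \<subseteq> monos_le n (r + 2 - edeg (fst i))"
        "f = (\<Sum>i\<in>square_index n r. Poly_Mapping.single (fst i) 1 * (q i)\<^sup>2)"
      by blast
    have "(\<Sum>a\<in>monos_le n (r + 2 - edeg \<beta>). (q (\<beta>, a))\<^sup>2) \<in> sos n (r + 2 - edeg \<beta>)" if "\<beta> \<in> ?B" for \<beta>
      unfolding sos_iff_card_squares using q(1) that by (intro exI[of _ "\<lambda>a. q (\<beta>, a)"]) (force simp: square_index_def)
    then show ?L
      using q(2) unfolding split
      by (intro exI[of _ "\<lambda>\<beta>. \<Sum>a\<in>monos_le n (r + 2 - edeg \<beta>). (q (\<beta>, a))\<^sup>2"]) blast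
  qed
  then show ?thesis
    unfolding cone_H_def by blast
qed

section \<open>Coefficientwise convergence\<close>

text \<open>
  On polynomials supported in a fixed finite set of monomials this is convergence in the usual topology
  of a finite-dimensional space. The uniform finite supports that make multiplication continuous are
  hypotheses of \<open>coeff_tendsto_mult\<close>.
\<close>

definition coeff_tendsto :: "(nat \<Rightarrow> rpoly) \<Rightarrow> rpoly \<Rightarrow> bool" where
  "coeff_tendsto P p \<longleftrightarrow>
    (\<forall>\<gamma>. (\<lambda>k. Poly_Mapping.lookup (P k) \<gamma>) \<longlonglongrightarrow> Poly_Mapping.lookup p \<gamma>)"

lemma coeff_tendsto_unique: "coeff_tendsto P p \<Longrightarrow> coeff_tendsto P q \<Longrightarrow> p = q"
  unfolding coeff_tendsto_def by (blast intro: poly_mapping_eqI LIMSEQ_unique)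

lemma coeff_tendsto_subseq:
  "coeff_tendsto P p \<Longrightarrow> strict_mono s \<Longrightarrow> coeff_tendsto (\<lambda>k. P (s k)) p"
  unfolding coeff_tendsto_def using LIMSEQ_subseq_LIMSEQ by (force simp: comp_def)

lemma coeff_tendsto_const: "coeff_tendsto (\<lambda>_. p) p"
  by (simp add: coeff_tendsto_def)

lemma coeff_tendsto_sum:
  "(\<And>i. i \<in> I \<Longrightarrow> coeff_tendsto (\<lambda>k. P k i) (p i)) \<Longrightarrow>
    coeff_tendsto (\<lambda>k. \<Sum>i\<in>I. P k i) (\<Sum>i\<in>I. p i)"
  unfolding coeff_tendsto_def lookup_sum by (auto intro!: tendsto_sum)

lemma coeff_tendsto_support:
  assumes "coeff_tendsto P p" "\<And>k. Poly_Mapping.keys (P k) \<subseteq> A"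
  shows "Poly_Mapping.keys p \<subseteq> A"
proof
  fix \<gamma> assume \<gamma>: "\<gamma> \<in> Poly_Mapping.keys p"
  show "\<gamma> \<in> A"
  proof (rule ccontr)
    assume "\<gamma> \<notin> A"
    then have "Poly_Mapping.lookup (P k) \<gamma> = 0" for k
      using assms(2)[of k] by (auto simp: in_keys_iff)
    then have "Poly_Mapping.lookup p \<gamma> = 0"
      using assms(1) LIMSEQ_const_iff[of 0] unfolding coeff_tendsto_def by (metis (no_types, lifting) ext)
    then show False
      using \<gamma> by (simp add: in_keys_iff)
  qed
qed

lemma coeff_tendsto_const_mult:
  assumes "t \<longlonglongrightarrow> \<tau>" "coeff_tendsto P p"
  shows "coeff_tendsto (\<lambda>k. Poly_Mapping.single 0 (t k) * P k) (Poly_Mapping.single 0 \<tau> * p)"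
  using assms unfolding coeff_tendsto_def lookup_const_mult by (auto intro: tendsto_mult)

lemma coeff_tendsto_mult:
  assumes "coeff_tendsto P p" "coeff_tendsto Q q" "finite A" "finite B"
    and "\<And>k. Poly_Mapping.keys (P k) \<subseteq> A" "\<And>k. Poly_Mapping.keys (Q k) \<subseteq> B"
  shows "coeff_tendsto (\<lambda>k. P k * Q k) (p * q)"
  unfolding coeff_tendsto_def
proof
  fix \<gamma>
  have "Poly_Mapping.lookup (P k * Q k) \<gamma> = (\<Sum>(a, b)\<in>A \<times> B. if \<gamma> = a + b
      then Poly_Mapping.lookup (P k) a * Poly_Mapping.lookup (Q k) b else 0)" for k
    using assms by (intro lookup_mult_finite) auto
  moreover have "Poly_Mapping.lookup (p * q) \<gamma> = (\<Sum>(a, b)\<in>A \<times> B. if \<gamma> = a + b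
      then Poly_Mapping.lookup p a * Poly_Mapping.lookup q b else 0)"
    using assms(3,4) coeff_tendsto_support[OF assms(1,5)] coeff_tendsto_support[OF assms(2,6)]
    by (rule lookup_mult_finite)
  ultimately show "(\<lambda>k. Poly_Mapping.lookup (P k * Q k) \<gamma>) \<longlonglongrightarrow> Poly_Mapping.lookup (p * q) \<gamma>"
    using assms(1,2) unfolding coeff_tendsto_def
    by (auto simp: split_beta intro!: tendsto_sum tendsto_mult)
qed

lemma finite_family_convergent_subseq:
  fixes X :: "'i \<Rightarrow> nat \<Rightarrow> real"
  assumes "finite I" "\<And>i. i \<in> I \<Longrightarrow> bounded (range (X i))"
  shows "\<exists>s L. strict_mono (s :: nat \<Rightarrow> nat) \<and> (\<forall>i\<in>I. (\<lambda>k. X i (s k)) \<longlonglongrightarrow> L i)"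
  using assms
proof (induction I rule: finite_induct)
  case empty
  show ?case
    by (auto intro: exI[of _ id] simp: strict_mono_def)
next
  case (insert i I)
  then obtain s L where s: "strict_mono s" "\<forall>i\<in>I. (\<lambda>k. X i (s k)) \<longlonglongrightarrow> L i"
    by blast
  have "bounded (range (\<lambda>k. X i (s k)))"
    by (rule bounded_subset[of "range (X i)"]) (use insert.prems in auto)
  then obtain l s' where s': "strict_mono s'" "((\<lambda>k. X i (s k)) \<circ> s') \<longlonglongrightarrow> l"
    using bounded_imp_convergent_subsequence by blast
  have "(\<lambda>k. X j ((s \<circ> s') k)) \<longlonglongrightarrow> (L(i := l)) j" if "j \<in> insert i I" for j
  proof (cases "j = i")
    case True
    then show ?thesis
      using s'(2) by (simp add: comp_def)
  next
    case False
    then show ?thesis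
      using that s(2) LIMSEQ_subseq_LIMSEQ[OF _ s'(1), of "\<lambda>k. X j (s k)"] by (auto simp: comp_def)
  qed
  then show ?case
    using strict_mono_o[OF s(1) s'(1)] by blast
qed

text \<open>Bolzano--Weierstrass for finitely many polynomials with supports in fixed finite sets.\<close>

lemma poly_family_convergent_subseq:
  fixes q :: "nat \<Rightarrow> 'i \<Rightarrow> rpoly"
  assumes "finite I" "\<And>i. i \<in> I \<Longrightarrow> finite (A i)"
    and supp: "\<And>k i. i \<in> I \<Longrightarrow> Poly_Mapping.keys (q k i) \<subseteq> A i"
    and bound: "\<And>k i \<gamma>. i \<in> I \<Longrightarrow> \<bar>Poly_Mapping.lookup (q k i) \<gamma>\<bar> \<le> b"
  shows "\<exists>s h. strict_mono s \<and> (\<forall>i\<in>I. coeff_tendsto (\<lambda>k. q (s k) i) (h i))"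
proof -
  define X where "X = (\<lambda>(i, \<gamma>) k. Poly_Mapping.lookup (q k i) \<gamma>)"
  have fin: "finite (Sigma I A)"
    using assms(1,2) by simp
  have "bounded (range (X z))" if "z \<in> Sigma I A" for z
    using that bound by (intro boundedI[of _ b]) (auto simp: X_def)
  then obtain s L where s: "strict_mono s" "\<And>z. z \<in> Sigma I A \<Longrightarrow> (\<lambda>k. X z (s k)) \<longlonglongrightarrow> L z"
    using finite_family_convergent_subseq[OF fin, of X] by blast
  define h where "h i = (\<Sum>\<gamma>\<in>A i. Poly_Mapping.single \<gamma> (L (i, \<gamma>)))" for i
  have "coeff_tendsto (\<lambda>k. q (s k) i) (h i)" if i: "i \<in> I" for i
    unfolding coeff_tendsto_def
  proof
    fix \<gamma>
    have h: "Poly_Mapping.lookup (h i) \<gamma> = (if \<gamma> \<in> A i then L (i, \<gamma>) else 0)"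
      using assms(2)[OF i] by (simp add: h_def lookup_sum lookup_single when_def)
    show "(\<lambda>k. Poly_Mapping.lookup (q (s k) i) \<gamma>) \<longlonglongrightarrow> Poly_Mapping.lookup (h i) \<gamma>"
    proof (cases "\<gamma> \<in> A i")
      case True
      then show ?thesis
        using s(2)[of "(i, \<gamma>)"] i by (simp add: h X_def)
    next
      case False
      then have "Poly_Mapping.lookup (q (s k) i) \<gamma> = 0" for k
        using supp[OF i, of "s k"] by (auto simp: in_keys_iff)
      then show ?thesis
        using False by (simp add: h)
    qed
  qed
  then show ?thesis
    using s(1) by blast
qed

section \<open>Closedness of the cone of weighted sums of squares\<close>

text \<open>
  The compactness argument for closedness of a cone generated by a compact set that avoids the origin,
  carried out without a bound on the \<open>q k i\<close>: these are divided by one plus the sum of the absolute values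
  of all their coefficients. The factors stay in \<open>(0, 1]\<close> whether or not the \<open>q k i\<close> are bounded, and
  their limit is zero only if the normalised polynomials tend to total size one, which
  \<open>weighted_squares_eq_0_imp\<close> rules out.
\<close>

lemma weighted_squares_closed:
  fixes \<beta> :: "'i \<Rightarrow> expo" and q :: "nat \<Rightarrow> 'i \<Rightarrow> rpoly"
  assumes "finite I" and fin: "\<And>i. i \<in> I \<Longrightarrow> finite (A i)"
    and supp: "\<And>k i. i \<in> I \<Longrightarrow> Poly_Mapping.keys (q k i) \<subseteq> A i"
    and lim: "coeff_tendsto (\<lambda>k. \<Sum>i\<in>I. Poly_Mapping.single (\<beta> i) 1 * (q k i)\<^sup>2) f"
  shows "\<exists>h. (\<forall>i\<in>I. Poly_Mapping.keys (h i) \<subseteq> A i) \<and>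
    f = (\<Sum>i\<in>I. Poly_Mapping.single (\<beta> i) 1 * (h i)\<^sup>2)"
proof -
  define S where "S g = (\<Sum>i\<in>I. \<Sum>\<gamma>\<in>A i. \<bar>Poly_Mapping.lookup (g i) \<gamma>\<bar>)" for g :: "'i \<Rightarrow> rpoly"
  define W where "W g = (\<Sum>i\<in>I. Poly_Mapping.single (\<beta> i) 1 * (g i)\<^sup>2)" for g :: "'i \<Rightarrow> rpoly"
  define t where "t k = 1 / (1 + S (q k))" for k
  define g where "g k i = Poly_Mapping.single 0 (t k) * q k i" for k i
  have S_nonneg: "0 \<le> S p" for p
    by (auto simp: S_def intro!: sum_nonneg)
  have t: "0 < t k" "t k \<le> 1" for k
    using S_nonneg[of "q k"] by (auto simp: t_def)
  have S_scale: "S (\<lambda>i. Poly_Mapping.single 0 c * p i) = \<bar>c\<bar> * S p" for c p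
    by (simp add: S_def lookup_const_mult abs_mult sum_distrib_left)
  have W_scale: "W (\<lambda>i. Poly_Mapping.single 0 c * p i) = Poly_Mapping.single 0 (c\<^sup>2) * W p" for c p
  proof -
    have "(Poly_Mapping.single 0 c * p i)\<^sup>2 = Poly_Mapping.single 0 (c\<^sup>2) * (p i)\<^sup>2" for i
      by (simp add: power_mult_distrib power2_eq_square[of "Poly_Mapping.single 0 c"] mult_single
        power2_eq_square[of c])
    then show ?thesis
      by (simp add: W_def sum_distrib_left mult.left_commute)
  qed
  have S_g: "S (g k) = 1 - t k" for k
    using S_nonneg[of "q k"] t(1)[of k] unfolding g_def S_scale by (simp add: t_def field_simps)
  have g_supp: "Poly_Mapping.keys (g k i) \<subseteq> A i" if "i \<in> I" for k i
    using supp[OF that, of k] keys_const_mult_subset[of "t k" "q k i"] by (auto simp: g_def)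
  have g_bound: "\<bar>Poly_Mapping.lookup (g k i) \<gamma>\<bar> \<le> 1" if i: "i \<in> I" for k i \<gamma>
  proof (cases "\<gamma> \<in> A i")
    case True
    have "\<bar>Poly_Mapping.lookup (g k i) \<gamma>\<bar> \<le> (\<Sum>\<gamma>\<in>A i. \<bar>Poly_Mapping.lookup (g k i) \<gamma>\<bar>)"
      using True fin[OF i] by (intro member_le_sum) auto
    also have "\<dots> \<le> S (g k)"
      unfolding S_def using i \<open>finite I\<close>
      by (intro member_le_sum[of i I "\<lambda>i. \<Sum>\<gamma>\<in>A i. \<bar>Poly_Mapping.lookup (g k i) \<gamma>\<bar>"])
        (auto intro: sum_nonneg)
    also have "\<dots> \<le> 1"
      using S_g t(1)[of k] by simp
    finally show ?thesis .
  next
    case False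
    then have "Poly_Mapping.lookup (g k i) \<gamma> = 0"
      using g_supp[OF i, of k] by (auto simp: in_keys_iff)
    then show ?thesis
      by simp
  qed
  obtain s1 h where s1: "strict_mono s1" "\<And>i. i \<in> I \<Longrightarrow> coeff_tendsto (\<lambda>k. g (s1 k) i) (h i)"
    using poly_family_convergent_subseq[where q = g and A = A and b = 1, OF \<open>finite I\<close> fin g_supp g_bound]
    by blast
  have "bounded (range (\<lambda>k. t (s1 k)))"
    using t by (intro boundedI[of _ 1]) (auto simp: abs_of_pos)
  then obtain \<tau> s2 where s2: "strict_mono s2" "(\<lambda>k. t (s1 (s2 k))) \<longlonglongrightarrow> \<tau>"
    using bounded_imp_convergent_subsequence by (force simp: comp_def)
  define s where "s k = s1 (s2 k)" for k
  have s: "strict_mono s"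
    using s1(1) s2(1) by (simp add: s_def strict_mono_def)
  have g_lim: "coeff_tendsto (\<lambda>k. g (s k) i) (h i)" if "i \<in> I" for i
    using coeff_tendsto_subseq[OF s1(2)[OF that] s2(1)] by (simp add: s_def)
  have t_lim: "(\<lambda>k. t (s k)) \<longlonglongrightarrow> \<tau>"
    using s2(2) by (simp add: s_def)
  have h_supp: "Poly_Mapping.keys (h i) \<subseteq> A i" if "i \<in> I" for i
    using coeff_tendsto_support[OF g_lim[OF that]] g_supp[OF that] by blast
  have "coeff_tendsto (\<lambda>k. W (g (s k))) (W h)"
    unfolding W_def
  proof (rule coeff_tendsto_sum)
    fix i assume i: "i \<in> I"
    have sq: "coeff_tendsto (\<lambda>k. (g (s k) i)\<^sup>2) ((h i)\<^sup>2)"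
      unfolding power2_eq_square
      by (rule coeff_tendsto_mult[OF g_lim g_lim fin fin g_supp g_supp]) (use i in auto)
    have "Poly_Mapping.keys ((g (s k) i)\<^sup>2) \<subseteq> (\<lambda>(a, b). a + b) ` (A i \<times> A i)" for k
      using keys_mult[of "g (s k) i" "g (s k) i"] g_supp[OF i, of "s k"]
      unfolding power2_eq_square by fastforce
    from coeff_tendsto_mult[OF coeff_tendsto_const sq _ _ order_refl this]
    show "coeff_tendsto (\<lambda>k. Poly_Mapping.single (\<beta> i) 1 * (g (s k) i)\<^sup>2)
        (Poly_Mapping.single (\<beta> i) 1 * (h i)\<^sup>2)"
      using fin[OF i] by simp
  qed
  moreover have "coeff_tendsto (\<lambda>k. W (g (s k))) (Poly_Mapping.single 0 (\<tau>\<^sup>2) * f)"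
  proof -
    have "W (g (s k)) = Poly_Mapping.single 0 ((t (s k))\<^sup>2) * W (q (s k))" for k
      unfolding g_def by (rule W_scale)
    then show ?thesis
      using coeff_tendsto_const_mult[OF tendsto_power[OF t_lim] coeff_tendsto_subseq[OF lim s]]
      by (simp add: W_def)
  qed
  ultimately have Wh: "W h = Poly_Mapping.single 0 (\<tau>\<^sup>2) * f"
    by (rule coeff_tendsto_unique)
  \<comment> \<open>Otherwise the normalised limits satisfy both \<open>S h = 0\<close> and \<open>S h = 1 - \<tau> = 1\<close>.\<close>
  have "\<tau> \<noteq> 0"
  proof
    assume "\<tau> = 0"
    then have "h i = 0" if "i \<in> I" for i
      using weighted_squares_eq_0_imp[OF \<open>finite I\<close> _ that, of \<beta> h] Wh by (simp add: W_def)
    then have "S h = 0"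
      by (simp add: S_def)
    moreover have "(\<lambda>k. S (g (s k))) \<longlonglongrightarrow> S h"
      using g_lim unfolding S_def coeff_tendsto_def by (auto intro!: tendsto_sum tendsto_rabs)
    moreover have "(\<lambda>k. S (g (s k))) \<longlonglongrightarrow> 1 - \<tau>"
      unfolding S_g by (intro tendsto_intros t_lim)
    ultimately show False
      using \<open>\<tau> = 0\<close> LIMSEQ_unique[of "\<lambda>k. S (g (s k))" "S h" "1 - \<tau>"] by simp
  qed
  have "W (\<lambda>i. Poly_Mapping.single 0 (1 / \<tau>) * h i) = f"
    using \<open>\<tau> \<noteq> 0\<close> unfolding W_scale Wh
    by (simp add: mult_single power_divide flip: mult.assoc)
  moreover have "Poly_Mapping.keys (Poly_Mapping.single 0 (1 / \<tau>) * h i) \<subseteq> A i" if "i \<in> I" for i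
    using h_supp[OF that] keys_const_mult_subset[of "1 / \<tau>" "h i"] by blast
  ultimately show ?thesis
    unfolding W_def by (intro exI[of _ "\<lambda>i. Poly_Mapping.single 0 (1 / \<tau>) * h i"]) simp
qed

lemma forms_keys_iff: "p \<in> forms n d \<longleftrightarrow> Poly_Mapping.keys p \<subseteq> {\<beta> \<in> expos n. edeg \<beta> = d}"
  by (auto simp: forms_def)

lemma finite_expos_edeg_eq: "finite {\<beta> \<in> expos n. edeg \<beta> = d}"
  by (rule finite_subset[OF _ finite_expos_edeg_le[of n d]]) auto

lemma cone_H_closed:
  assumes "\<And>k. F k \<in> cone_H n r" "coeff_tendsto F f"
  shows "f \<in> cone_H n r"
proof -
  have "\<forall>k. \<exists>q. (\<forall>i\<in>square_index n r.
        Poly_Mapping.keys (q i) \<subseteq> monos_le n (r + 2 - edeg (fst i))) \<and>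
      F k = (\<Sum>i\<in>square_index n r. Poly_Mapping.single (fst i) 1 * (q i)\<^sup>2)"
    using assms(1) unfolding cone_H_iff_squares by (intro allI) (rule conjunct2)
  from choice[OF this] obtain q where
    q: "\<And>k i. i \<in> square_index n r \<Longrightarrow>
        Poly_Mapping.keys (q k i) \<subseteq> monos_le n (r + 2 - edeg (fst i))"
      "\<And>k. F k = (\<Sum>i\<in>square_index n r. Poly_Mapping.single (fst i) 1 * (q k i)\<^sup>2)"
    by auto
  have "Poly_Mapping.keys (F k) \<subseteq> {\<beta> \<in> expos n. edeg \<beta> = r + 2}" for k
    using assms(1)[of k] unfolding cone_H_iff_squares forms_keys_iff by (rule conjunct1)
  then have "f \<in> forms n (r + 2)"
    unfolding forms_keys_iff by (rule coeff_tendsto_support[OF assms(2)])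
  moreover have "\<exists>h. (\<forall>i\<in>square_index n r. Poly_Mapping.keys (h i) \<subseteq> monos_le n (r + 2 - edeg (fst i))) \<and>
      f = (\<Sum>i\<in>square_index n r. Poly_Mapping.single (fst i) 1 * (h i)\<^sup>2)"
  proof (rule weighted_squares_closed[OF finite_square_index finite_monos_le q(1)])
    show "coeff_tendsto (\<lambda>k. \<Sum>i\<in>square_index n r. Poly_Mapping.single (fst i) 1 * (q k i)\<^sup>2) f"
      using assms(2) unfolding q(2)[symmetric] .
  qed
  ultimately show ?thesis
    unfolding cone_H_iff_squares by blast
qed

section \<open>Multipliers and quadratic forms\<close>

lemma l1norm_eq_sum_superset:
  assumes "finite A" "Poly_Mapping.keys p \<subseteq> A"
  shows "l1norm p = (\<Sum>\<gamma>\<in>A. \<bar>Poly_Mapping.lookup p \<gamma>\<bar>)"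
  unfolding l1norm_def using assms by (intro sum.mono_neutral_left) (auto simp: in_keys_iff)

lemma abs_lookup_le_l1norm: "\<bar>Poly_Mapping.lookup p \<gamma>\<bar> \<le> l1norm p"
proof -
  have "l1norm p = (\<Sum>\<gamma>\<in>insert \<gamma> (Poly_Mapping.keys p). \<bar>Poly_Mapping.lookup p \<gamma>\<bar>)"
    by (rule l1norm_eq_sum_superset) auto
  then show ?thesis
    using member_le_sum[of \<gamma> "insert \<gamma> (Poly_Mapping.keys p)" "\<lambda>\<gamma>. \<bar>Poly_Mapping.lookup p \<gamma>\<bar>"] by simp
qed

lemma multipliers_compact:
  fixes P :: "nat \<Rightarrow> rpoly"
  assumes "\<And>k. P k \<in> nonneg_forms n r" "\<And>k. l1norm (P k) = 1"
  shows "\<exists>s p. strict_mono s \<and> coeff_tendsto (\<lambda>k. P (s k)) p \<and> p \<in> nonneg_forms n r \<and> l1norm p = 1"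
proof -
  let ?A = "{\<beta> \<in> expos n. edeg \<beta> = r}"
  have supp: "Poly_Mapping.keys (P k) \<subseteq> ?A" and nonneg: "0 \<le> Poly_Mapping.lookup (P k) \<gamma>" for k \<gamma>
    using assms(1) unfolding nonneg_forms_def forms_keys_iff by auto
  obtain s p where s: "strict_mono s" "coeff_tendsto (\<lambda>k. P (s k)) p"
    using poly_family_convergent_subseq[of "{()}" "\<lambda>_. ?A" "\<lambda>k _. P k" 1]
      supp finite_expos_edeg_eq abs_lookup_le_l1norm[of "P _", unfolded assms(2)] by auto
  have p: "Poly_Mapping.keys p \<subseteq> ?A"
    using coeff_tendsto_support[OF s(2) supp] .
  have lim: "(\<lambda>k. Poly_Mapping.lookup (P (s k)) \<gamma>) \<longlonglongrightarrow> Poly_Mapping.lookup p \<gamma>" for \<gamma>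
    using s(2) by (simp add: coeff_tendsto_def)
  have "0 \<le> Poly_Mapping.lookup p \<gamma>" for \<gamma>
    using LIMSEQ_le_const[OF lim] nonneg by blast
  then have "p \<in> nonneg_forms n r"
    using p unfolding nonneg_forms_def forms_keys_iff by blast
  moreover have "(\<lambda>k. l1norm (P (s k))) \<longlonglongrightarrow> l1norm p"
    unfolding l1norm_eq_sum_superset[OF finite_expos_edeg_eq supp]
      l1norm_eq_sum_superset[OF finite_expos_edeg_eq p]
    by (intro tendsto_sum tendsto_rabs lim)
  then have "l1norm p = 1"
    by (simp add: assms(2) LIMSEQ_const_iff)
  ultimately show ?thesis
    using s by blast
qed

lemma keys_quad_form:
  "Poly_Mapping.keys (quad_form n M) \<subseteq>
    (\<lambda>(i, j). Poly_Mapping.single i 1 + Poly_Mapping.single j 1) ` ({..<n} \<times> {..<n})"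
proof -
  have eq: "quad_form n M = (\<Sum>(i, j)\<in>{..<n} \<times> {..<n}.
      Poly_Mapping.single (Poly_Mapping.single i 1 + Poly_Mapping.single j 1) (M i j))"
    by (simp add: quad_form_def sum.cartesian_product)
  show ?thesis
    unfolding eq
    by (rule order_trans[OF keys_sum]) (clarsimp simp: image_iff split: if_splits, blast)
qed

lemma coeff_tendsto_quad_form:
  assumes "\<And>i j. (\<lambda>k. M k i j) \<longlonglongrightarrow> N i j"
  shows "coeff_tendsto (\<lambda>k. quad_form n (M k)) (quad_form n N)"
  unfolding quad_form_def
proof (intro coeff_tendsto_sum)
  fix i j
  show "coeff_tendsto (\<lambda>k. Poly_Mapping.single (Poly_Mapping.single i 1 + Poly_Mapping.single j 1)
      (M k i j)) (Poly_Mapping.single (Poly_Mapping.single i 1 + Poly_Mapping.single j 1) (N i j))"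
    using assms by (simp add: coeff_tendsto_def lookup_single when_def)
qed

theorem proposition3p4:
  fixes n r :: nat
  shows "closedin (top_of_set (sym_mats n)) (Q_tilde n r)"
proof (rule closed_subset)
  show "Q_tilde n r \<subseteq> sym_mats n"
    by (auto simp: Q_tilde_def)
  show "closed (Q_tilde n r)"
    unfolding closed_sequential_limits
  proof (intro allI impI, elim conjE)
    fix M :: "nat \<Rightarrow> nat \<Rightarrow> nat \<Rightarrow> real" and N
    assume M: "\<forall>k. M k \<in> Q_tilde n r" and lim: "M \<longlonglongrightarrow> N"
    have entries: "(\<lambda>k. M k i j) \<longlonglongrightarrow> N i j" for i j
    proof -
      have "continuous_on UNIV (\<lambda>A::nat \<Rightarrow> nat \<Rightarrow> real. A i j)"
        by (rule continuous_on_product_then_coordinatewise[OF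
              continuous_on_product_then_coordinatewise[OF continuous_on_id]])
      then show ?thesis
        using continuous_on_tendsto_compose[OF _ lim] by force
    qed
    have "N \<in> sym_mats n"
    proof -
      have "N i j = N j i" for i j
      proof -
        have "M k j i = M k i j" for k
          using M by (simp add: Q_tilde_def sym_mats_def)
        then show ?thesis
          using entries[of i j] entries[of j i] by (simp add: LIMSEQ_unique)
      qed
      moreover have "N i j = 0" if "\<not> (i < n \<and> j < n)" for i j
      proof -
        have "M k i j = 0" for k
          using M that by (simp add: Q_tilde_def sym_mats_def)
        then show ?thesis
          using entries[of i j] by (simp add: LIMSEQ_const_iff)
      qed
      ultimately show ?thesis
        by (simp add: sym_mats_def)
    qed
    moreover have "\<forall>k. \<exists>p. p \<in> nonneg_forms n r \<and> l1norm p = 1 \<and> p * quad_form n (M k) \<in> cone_H n r"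
      using M unfolding Q_tilde_def by blast
    from choice[OF this] obtain P where P: "\<And>k. P k \<in> nonneg_forms n r" "\<And>k. l1norm (P k) = 1"
        "\<And>k. P k * quad_form n (M k) \<in> cone_H n r"
      by blast
    obtain s p where s: "strict_mono s" "coeff_tendsto (\<lambda>k. P (s k)) p"
        and p: "p \<in> nonneg_forms n r" "l1norm p = 1"
      using multipliers_compact[of P n r, OF P(1,2)] by blast
    have "coeff_tendsto (\<lambda>k. P (s k) * quad_form n (M (s k))) (p * quad_form n N)"
    proof (rule coeff_tendsto_mult[OF s(2) _ finite_expos_edeg_eq _ _ keys_quad_form])
      show "coeff_tendsto (\<lambda>k. quad_form n (M (s k))) (quad_form n N)"
        by (rule coeff_tendsto_subseq[OF coeff_tendsto_quad_form[OF entries] s(1)])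
      show "Poly_Mapping.keys (P (s k)) \<subseteq> {\<beta> \<in> expos n. edeg \<beta> = r}" for k
        using P(1)[of "s k"] by (simp add: nonneg_forms_def forms_keys_iff)
    qed simp
    then have "p * quad_form n N \<in> cone_H n r"
      using P(3) by (rule cone_H_closed[rotated])
    ultimately show "N \<in> Q_tilde n r"
      using p by (auto simp: Q_tilde_def)
  qed
qed

end
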